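(* There exists an infinite sequence $A = \{a_1 < a_2 < \dots\}$ of squarefree positive integers which has property $Q$ and has natural density $\frac{6}{\pi^2}$; equivalently, $a_j/j \to \frac{\pi^2}{6}$ as $j \to \infty$.
   Context: $\mathrm{SF}$ denotes the set of squarefree positive integers. A set $A \subseteq \mathbb{N}$ has property $Q$ if there are infinitely many $n \in \mathbb{N}$ such that $n + a \in \mathrm{SF}$ for all $a \in A$ with $a < n$. For $x > 0$, $[x] = \{n \in \mathbb{N} : n \le x\}$; the natural density of $A$ is $\lim_{x\to\infty}|A \cap [x]|/x$. *)

theory Defs
  imports "HOL-Analysis.Analysis" "HOL-Computational_Algebra.Squarefree"
begin

text \<open>Subsets of the positive integers are represented as sets of type \<^typ>\<open>nat set\<close>;
  the number \<open>0\<close> is excluded explicitly wherever the mathematics ranges over \<open>n \<ge> 1\<close>.\<close>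

definition SF :: "nat set" where
  "SF = {n. 0 < n \<and> squarefree n}"

definition property_Q :: "nat set \<Rightarrow> bool" where
  "property_Q A \<longleftrightarrow> infinite {n. 0 < n \<and> (\<forall>a\<in>A. a < n \<longrightarrow> n + a \<in> SF)}"

definition initial_seg :: "real \<Rightarrow> nat set" where
  "initial_seg x = {n. 0 < n \<and> real n \<le> x}"

text \<open>The limit is taken over real \<open>x\<close>.\<close>

definition has_natural_density :: "nat set \<Rightarrow> real \<Rightarrow> bool" where
  "has_natural_density A d \<longleftrightarrow>
     ((\<lambda>x::real. real (card (A \<inter> initial_seg x)) / x) \<longlongrightarrow> d) at_top"

end

theory Submission
  imports Defs "HOL-Real_Asymp.Real_Asymp"
begin

text \<open>
  Density of the squarefree numbers: writing every \<open>n \<le> x\<close> uniquely as a squarefree number times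
  \<open>d\<^sup>2\<close> gives \<open>\<lfloor>x\<rfloor> = (\<Sum>d. S (x / d\<^sup>2))\<close> for the counting function \<open>S\<close> of the squarefree numbers.
  Hence the error \<open>g x = S x / x - 6 / pi\<^sup>2\<close> satisfies \<open>g x = o(1) - (\<Sum>d\<ge>2. g (x / d\<^sup>2) / d\<^sup>2)\<close>, and as
  \<open>(\<Sum>d\<ge>2. 1 / d\<^sup>2) < 1\<close> this forces \<open>g x\<close> to tend to \<open>0\<close>.

  Good shifts: let \<open>n = m * (fact y)\<^sup>2\<close>. If \<open>a\<close> is squarefree and \<open>n + a\<close> is not, then \<open>p\<^sup>2 dvd n + a\<close>
  for a prime \<open>p > y\<close>. With \<open>r\<close> the distance from \<open>n\<close> to the next multiple of \<open>p\<^sup>2\<close>, at most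
  \<open>2 x / r\<close> numbers \<open>a \<le> x\<close> are affected by \<open>p\<close>, for every \<open>x\<close> at once. The average of \<open>1 / r\<close>
  over \<open>m\<close> is about \<open>ln (p\<^sup>2) / p\<^sup>2\<close>, which is summable, so for large \<open>y\<close> some \<open>m\<close> makes the total number
  of exceptions up to \<open>x\<close> at most \<open>\<epsilon> x\<close> for all \<open>x\<close>. Removing from the squarefree numbers the
  exceptions of a sequence of such shifts with \<open>\<epsilon> = 2\<^sup>-\<^sup>k\<close> removes only a set of density zero.
\<close>

section \<open>Density of the squarefree numbers\<close>

lemma initial_seg_eq: "initial_seg x = {1..nat \<lfloor>x\<rfloor>}"
  by (auto simp: initial_seg_def le_nat_floor le_floor_iff nat_le_iff Suc_le_eq) linarith+

lemma finite_initial_seg [simp]: "finite (initial_seg x)"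
  by (simp add: initial_seg_eq)

text \<open>Compare exponents prime by prime: a prime has exponent at most 1 in \<open>s\<close>,
  and this is lost when its exponent in \<open>s * d\<^sup>2\<close> is halved and rounded
  down.\<close>

lemma square_part_mult_square:
  fixes s d :: nat
  assumes "squarefree s" "d > 0"
  shows "square_part (s * d\<^sup>2) = d"
proof (rule multiplicity_eq_nat)
  have s: "s > 0" using assms(1) by (metis gr0I not_squarefree_0)
  show "0 < square_part (s * d\<^sup>2)" "0 < d" using s assms square_part_0_iff[of "s * d\<^sup>2"] by (auto simp del: square_part_0_iff intro!: gr0I)
  fix p :: nat assume p: "prime p"
  have "multiplicity p s \<le> 1"
    using assms(1) s p by (subst (asm) squarefree_factorial_semiring'') auto
  moreover have "multiplicity p (s * d\<^sup>2) = multiplicity p s + 2 * multiplicity p d"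
    using s assms p
    by (simp add: prime_elem_multiplicity_mult_distrib prime_elem_multiplicity_power_distrib)
  ultimately show "multiplicity p (square_part (s * d\<^sup>2)) = multiplicity p d"
    using p by (simp add: prime_multiplicity_square_part)
qed

definition sf_count :: "real \<Rightarrow> real" where
  "sf_count x = real (card (SF \<inter> initial_seg x))"

lemma sf_count_nonneg: "sf_count x \<ge> 0"
  by (simp add: sf_count_def)

lemma sf_count_le:
  assumes "x \<ge> 0"
  shows "sf_count x \<le> x"
proof -
  have "card (SF \<inter> initial_seg x) \<le> card (initial_seg x)" by (intro card_mono) auto
  thus ?thesis using assms unfolding sf_count_def initial_seg_eq by simp linarith
qed

text \<open>Sort the numbers up to \<open>x\<close> by square part; sending \<open>s\<close> to
  \<open>s * d\<^sup>2\<close> identifies the fibre over \<open>d\<close> with the squarefree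
  numbers up to \<open>x / d\<^sup>2\<close>. Fibres with \<open>d > x\<close> are empty, so
  \<open>D\<close> may be large, which the later splitting of the sum uses.\<close>

lemma sum_sf_count:
  assumes "x > 0" "nat \<lfloor>x\<rfloor> \<le> D"
  shows "real_of_int \<lfloor>x\<rfloor> = (\<Sum>d=1..D. sf_count (x / (real d)\<^sup>2))"
proof -
  define F where "F = (\<lambda>d. {n \<in> initial_seg x. square_part n = d})"
  have part: "initial_seg x = (\<Union>d\<in>{1..D}. F d)"
  proof (intro equalityI subsetI)
    fix n assume n: "n \<in> initial_seg x"
    hence n0: "n > 0" "n \<le> D" using assms by (auto simp: initial_seg_eq)
    have "square_part n dvd n"
      using square_part_square_dvd[of n] by (metis dvd_mult_left power2_eq_square)
    from dvd_imp_le[OF this] have "square_part n \<le> D" using n0 by linarith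
    moreover have "square_part n \<ge> 1" using n0 square_part_0_iff[of n] by linarith
    ultimately show "n \<in> (\<Union>d\<in>{1..D}. F d)" using n by (auto simp: F_def)
  qed (auto simp: F_def)
  have cardF: "card (F d) = card (SF \<inter> initial_seg (x / (real d)\<^sup>2))" if d: "d \<in> {1..D}" for d
  proof -
    have "bij_betw (\<lambda>s. s * d\<^sup>2) (SF \<inter> initial_seg (x / (real d)\<^sup>2)) (F d)"
    proof (rule bij_betw_byWitness[where f' = squarefree_part])
      show "\<forall>a\<in>SF \<inter> initial_seg (x / (real d)\<^sup>2). squarefree_part (a * d\<^sup>2) = a"
      proof
        fix a assume "a \<in> SF \<inter> initial_seg (x / (real d)\<^sup>2)"
        hence "squarefree a" by (auto simp: SF_def)
        from square_part_mult_square[OF this, of d] squarefree_decompose[of "a * d\<^sup>2"] d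
        show "squarefree_part (a * d\<^sup>2) = a" by auto
      qed
      show "\<forall>a'\<in>F d. squarefree_part a' * d\<^sup>2 = a'"
        using squarefree_decompose[symmetric] unfolding F_def by auto
      show "(\<lambda>s. s * d\<^sup>2) ` (SF \<inter> initial_seg (x / (real d)\<^sup>2)) \<subseteq> F d"
        using d square_part_mult_square
        by (auto simp: F_def SF_def initial_seg_def field_simps)
      show "squarefree_part ` F d \<subseteq> SF \<inter> initial_seg (x / (real d)\<^sup>2)"
      proof
        fix s assume "s \<in> squarefree_part ` F d"
        then obtain n where n: "n \<in> F d" "s = squarefree_part n" by blast
        have "real n = real s * (real d)\<^sup>2"
          using squarefree_decompose[of n] n by (metis (mono_tags, lifting) F_def mem_Collect_eq of_nat_mult of_nat_power)
        moreover have "real n \<le> x" using n by (auto simp: F_def initial_seg_def)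
        ultimately have "real s \<le> x / (real d)\<^sup>2" using d by (simp add: field_simps)
        moreover have "squarefree s" using n by auto
        ultimately show "s \<in> SF \<inter> initial_seg (x / (real d)\<^sup>2)"
          by (auto simp: SF_def initial_seg_def intro!: gr0I)
      qed
    qed
    thus ?thesis by (simp add: bij_betw_same_card)
  qed
  have "card (initial_seg x) = (\<Sum>d=1..D. card (F d))"
    unfolding part by (rule card_UN_disjoint) (auto simp: F_def)
  hence "real (card (initial_seg x)) = (\<Sum>d=1..D. sf_count (x / (real d)\<^sup>2))"
    using cardF by (simp add: sf_count_def)
  thus ?thesis using assms by (simp add: initial_seg_eq)
qed

lemma sum_inverse_squares_tendsto:
  "(\<lambda>n. \<Sum>d=1..n. 1 / (real d)\<^sup>2) \<longlonglongrightarrow> pi\<^sup>2 / 6"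
proof -
  have "(\<Sum>d=1..n. 1 / (real d)\<^sup>2) = (\<Sum>d<n. 1 / (real d + 1)\<^sup>2)" for n
    by (rule sum.reindex_bij_witness[of _ "\<lambda>d. d + 1" "\<lambda>d. d - 1"]) auto
  thus ?thesis using inverse_squares_sums by (simp add: sums_def add.commute)
qed

lemma sum_inverse_squares_le: "(\<Sum>d=1..n. 1 / (real d)\<^sup>2) \<le> pi\<^sup>2 / 6"
  by (rule incseq_le[OF _ sum_inverse_squares_tendsto]) (auto intro!: incseq_SucI)

text \<open>This supplies the contraction factor: without the term for 1, the inverse squares sum to
  at most 3/4.\<close>

lemma pi_squared_le: "pi\<^sup>2 / 6 \<le> 7 / 4"
proof -
  \<comment> \<open>Subtracting \<open>1 / real n\<close> lets the induction telescope. Starting at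
    2 yields the constant 7/4, as 1 + 1/4 = 7/4 - 1/2; starting at 1 would yield 2 and hence no
    contraction.\<close>
  have *: "(\<Sum>d=1..n. 1 / (real d)\<^sup>2) \<le> 7 / 4 - 1 / real n" if "n \<ge> 2" for n
    using that
  proof (induction n rule: dec_induct)
    case base
    have "{1..2} = {1, 2::nat}" by auto
    thus ?case by simp
  next
    case (step n)
    have "1 / (real (Suc n))\<^sup>2 \<le> 1 / real n - 1 / real (Suc n)"
    proof -
      have "1 / real n - 1 / real (Suc n) = 1 / (real n * real (Suc n))"
        using step by (simp add: field_simps)
      also have "\<dots> \<ge> 1 / (real (Suc n))\<^sup>2"
        unfolding power2_eq_square using step
        by (intro divide_left_mono mult_right_mono mult_pos_pos) auto
      finally show ?thesis .
    qed
    thus ?case using step by simp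
  qed
  have "(\<Sum>d=1..n. 1 / (real d)\<^sup>2) \<le> 7 / 4" if "n \<ge> 2" for n
    using *[OF that] by (meson diff_le_eq le_add_same_cancel1 of_nat_0_le_iff order_trans zero_le_divide_1_iff)
  thus ?thesis using LIMSEQ_le_const2[OF sum_inverse_squares_tendsto] by blast
qed

text \<open>One round of a self-improving bound on the error \<open>g\<close>. For a given
  \<open>x\<close> the eventual bound \<open>B\<close> is available at \<open>x / d\<^sup>2\<close>
  only for small \<open>d\<close>, so it is used for \<open>d\<close> from 2 to \<open>K\<close>,
  with total weight at most 3/4. Beyond \<open>K\<close> the trivial bound 1 on the error suffices,
  since the remaining weights are small.\<close>

lemma squarefree_density_contraction:
  fixes B \<epsilon> :: real
  defines "g \<equiv> (\<lambda>x. sf_count x / x - 6 / pi\<^sup>2)"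
  assumes B: "B \<ge> 0" "eventually (\<lambda>x. \<bar>g x\<bar> \<le> B) at_top" and "\<epsilon> > 0"
  shows "eventually (\<lambda>x. \<bar>g x\<bar> \<le> 3 / 4 * B + \<epsilon>) at_top"
proof -
  define c :: real where "c = 6 / pi\<^sup>2"
  define \<zeta> :: real where "\<zeta> = pi\<^sup>2 / 6"
  define H where "H = (\<lambda>n. \<Sum>d=1..n. 1 / (real d)\<^sup>2)"
  have H_le: "H n \<le> \<zeta>" for n using sum_inverse_squares_le by (simp add: H_def \<zeta>_def)
  have c\<zeta>: "c * \<zeta> = 1" by (simp add: c_def \<zeta>_def)
  have "H 1 = 1" by (simp add: H_def)
  with H_le[of 1] have \<zeta>1: "\<zeta> \<ge> 1" by simp
  have "c = 1 / \<zeta>" by (simp add: c_def \<zeta>_def)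
  with \<zeta>1 have c1: "0 \<le> c" "c \<le> 1" by auto
  have g_le: "\<bar>g x\<bar> \<le> 1" if "x > 0" for x
  proof -
    have "0 \<le> sf_count x / x" "sf_count x / x \<le> 1"
      using that sf_count_nonneg sf_count_le[of x] by auto
    thus ?thesis using c1 unfolding g_def c_def[symmetric] by linarith
  qed
  have "eventually (\<lambda>n. H n > \<zeta> - \<epsilon> / 4) sequentially"
    using order_tendstoD(1)[OF sum_inverse_squares_tendsto, of "\<zeta> - \<epsilon> / 4"] assms
    by (simp add: H_def \<zeta>_def)
  then obtain K0 where K0: "\<And>n. n \<ge> K0 \<Longrightarrow> H n > \<zeta> - \<epsilon> / 4"
    by (auto simp: eventually_at_top_linorder)
  define K where "K = max K0 1"
  have K: "K \<ge> 1" "H K > \<zeta> - \<epsilon> / 4" using K0[of K] by (auto simp: K_def)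
  from B obtain X where X: "\<And>x. x \<ge> X \<Longrightarrow> \<bar>g x\<bar> \<le> B"
    by (auto simp: eventually_at_top_linorder)
  show ?thesis
    unfolding eventually_at_top_linorder
  proof (intro exI allI impI)
    \<comment> \<open>The first threshold puts \<open>x / d\<^sup>2\<close> beyond \<open>X\<close>
      for all \<open>d \<le> K\<close> at once; the second makes the rounding error
      \<open>1 / x\<close> at most \<open>\<epsilon> / 2\<close>.\<close>
    fix x assume x: "x \<ge> max (max X 0 * (real K)\<^sup>2) (max 1 (2 / \<epsilon>))"
    hence x0: "x \<ge> 1" "1 / x \<le> \<epsilon> / 2" using \<open>\<epsilon> > 0\<close> by (auto simp: field_simps)
    define D where "D = max K (nat \<lfloor>x\<rfloor>)"
    define f where "f = (\<lambda>d. g (x / (real d)\<^sup>2) / (real d)\<^sup>2)"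
    have "real_of_int \<lfloor>x\<rfloor> / x = (\<Sum>d=1..D. sf_count (x / (real d)\<^sup>2) / x)"
      using sum_sf_count[of x D] x0 by (simp add: D_def sum_divide_distrib)
    also have "\<dots> = (\<Sum>d=1..D. f d + c * (1 / (real d)\<^sup>2))"
      by (rule sum.cong) (use x0 in \<open>auto simp: f_def g_def c_def field_simps\<close>)
    also have "\<dots> = (\<Sum>d=1..D. f d) + c * H D"
      by (simp add: H_def sum.distrib sum_distrib_left)
    also have "(\<Sum>d=1..D. f d) = f 1 + (\<Sum>d=2..K. f d) + (\<Sum>d=K+1..D. f d)"
    proof -
      have "{1..D} = {1} \<union> ({2..K} \<union> {K+1..D})" using K by (auto simp: D_def)
      also have "sum f \<dots> = f 1 + (sum f ({2..K} \<union> {K+1..D}))"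
        by (subst sum.union_disjoint) (use K in auto)
      also have "sum f ({2..K} \<union> {K+1..D}) = sum f {2..K} + sum f {K+1..D}"
        by (subst sum.union_disjoint) auto
      finally show ?thesis by simp
    qed
    \<comment> \<open>\<open>f 1\<close> is \<open>g x\<close> itself, so the identity can be solved
      for it. The main terms sum to \<open>c * H D\<close>, which is close to
      \<open>c * \<zeta> = 1\<close>.\<close>
    finally have eq: "g x = (real_of_int \<lfloor>x\<rfloor> / x - 1) + (1 - c * H D) - (\<Sum>d=2..K. f d) - (\<Sum>d=K+1..D. f d)"
      by (simp add: f_def)
    have HD: "H D = H K + (\<Sum>d=K+1..D. 1 / (real d)\<^sup>2)"
    proof -
      have "{1..D} = {1..K} \<union> {K+1..D}" by (auto simp: D_def)
      thus ?thesis unfolding H_def by (simp add: sum.union_disjoint)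
    qed
    have HK: "H K = 1 + (\<Sum>d=2..K. 1 / (real d)\<^sup>2)"
      unfolding H_def using K by (simp add: sum.atLeast_Suc_atMost numeral_2_eq_2)
    have "\<bar>real_of_int \<lfloor>x\<rfloor> / x - 1\<bar> = \<bar>real_of_int \<lfloor>x\<rfloor> - x\<bar> / x"
      using x0 by (simp add: field_simps abs_if)
    also have "\<dots> \<le> 1 / x" by (rule divide_right_mono) (use x0 in linarith)+
    finally have 1: "\<bar>real_of_int \<lfloor>x\<rfloor> / x - 1\<bar> \<le> \<epsilon> / 2" using x0 by linarith
    have "1 - c * H D = c * (\<zeta> - H D)" using c\<zeta> by (simp add: algebra_simps)
    moreover have "\<dots> \<le> 1 * (\<zeta> - H D)" using c1 H_le[of D] by (intro mult_right_mono) auto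
    moreover have "c * (\<zeta> - H D) \<ge> 0" using c1 H_le[of D] by auto
    ultimately have 2: "\<bar>1 - c * H D\<bar> \<le> \<zeta> - H D" by simp
    have "\<bar>\<Sum>d=2..K. f d\<bar> \<le> (\<Sum>d=2..K. B * (1 / (real d)\<^sup>2))"
    proof (rule sum_abs[THEN order_trans], rule sum_mono)
      fix d assume d: "d \<in> {2..K}"
      have "X * (real d)\<^sup>2 \<le> max X 0 * (real K)\<^sup>2"
        using d by (intro mult_mono power_mono) auto
      also have "\<dots> \<le> x" using x by simp
      finally have "X \<le> x / (real d)\<^sup>2" using d by (simp add: field_simps)
      from X[OF this] show "\<bar>f d\<bar> \<le> B * (1 / (real d)\<^sup>2)"
        by (simp add: f_def abs_divide divide_right_mono)
    qed
    also have "\<dots> = B * (H K - 1)" by (simp add: HK sum_distrib_left)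
    also have "\<dots> \<le> B * (3 / 4)"
      using B H_le[of K] pi_squared_le by (intro mult_left_mono) (auto simp: \<zeta>_def)
    finally have 3: "\<bar>\<Sum>d=2..K. f d\<bar> \<le> B * (3 / 4)" .
    have "\<bar>\<Sum>d=K+1..D. f d\<bar> \<le> (\<Sum>d=K+1..D. 1 / (real d)\<^sup>2)"
    proof (rule sum_abs[THEN order_trans], rule sum_mono)
      fix d assume d: "d \<in> {K+1..D}"
      have "x / (real d)\<^sup>2 > 0" using x0 d by auto
      from g_le[OF this] show "\<bar>f d\<bar> \<le> 1 / (real d)\<^sup>2"
        by (simp add: f_def abs_divide divide_right_mono)
    qed
    hence 4: "\<bar>\<Sum>d=K+1..D. f d\<bar> \<le> H D - H K" by (simp add: HD)
    \<comment> \<open>The bounds 2 and 4 add up to \<open>\<zeta> - H K\<close>, below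
      \<open>\<epsilon> / 4\<close> by the choice of \<open>K\<close>; together with the rounding
      error this stays below \<open>\<epsilon>\<close>.\<close>
    show "\<bar>g x\<bar> \<le> 3 / 4 * B + \<epsilon>"
      using eq 1 2 3 4 K \<open>\<epsilon> > 0\<close> unfolding abs_le_iff by linarith
  qed
qed

theorem squarefree_density: "has_natural_density SF (6 / pi\<^sup>2)"
proof -
  define g where "g = (\<lambda>x. sf_count x / x - 6 / pi\<^sup>2)"
  have *: "eventually (\<lambda>x. \<bar>g x\<bar> \<le> 2 * (7 / 8) ^ k) at_top" for k
  proof (induction k)
    case 0
    have "6 / pi\<^sup>2 \<le> 1"
      using sum_inverse_squares_le[of 1] by (simp add: field_simps)
    have "0 \<le> 6 / pi\<^sup>2" by simp
    show ?case
    proof (rule eventually_mono[OF eventually_gt_at_top[of 0]])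
      fix x :: real assume "x > 0"
      hence "0 \<le> sf_count x / x" "sf_count x / x \<le> 1"
        using sf_count_nonneg sf_count_le[of x] by auto
      thus "\<bar>g x\<bar> \<le> 2 * (7 / 8) ^ 0"
        using \<open>6 / pi\<^sup>2 \<le> 1\<close> \<open>0 \<le> 6 / pi\<^sup>2\<close> unfolding g_def power_0 by linarith
    qed
  next
    case (Suc k)
    \<comment> \<open>Spending an eighth of the current bound as \<open>\<epsilon>\<close> gives the
      ratio 3/4 + 1/8 = 7/8.\<close>
    from squarefree_density_contraction[OF _ Suc.IH[unfolded g_def], of "1 / 8 * (2 * (7 / 8) ^ k)"]
    show ?case by (simp add: g_def)
  qed
  have "(g \<longlongrightarrow> 0) at_top"
  proof (rule tendstoI)
    fix e :: real assume "e > 0"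
    have "(\<lambda>k. 2 * (7 / 8 :: real) ^ k) \<longlonglongrightarrow> 0"
      by (rule tendsto_mult_right_zero, rule LIMSEQ_realpow_zero) auto
    hence "eventually (\<lambda>k. 2 * (7 / 8 :: real) ^ k < e) sequentially"
      using \<open>e > 0\<close> by (rule order_tendstoD)
    then obtain k where k: "2 * (7 / 8 :: real) ^ k < e"
      by (auto simp: eventually_at_top_linorder)
    show "eventually (\<lambda>x. dist (g x) 0 < e) at_top"
      using *[of k] by eventually_elim (use k in \<open>simp add: dist_real_def\<close>)
  qed
  hence "((\<lambda>x. sf_count x / x) \<longlongrightarrow> 6 / pi\<^sup>2) at_top"
    unfolding g_def by (rule LIM_zero_cancel)
  thus ?thesis unfolding has_natural_density_def sf_count_def .
qed

section \<open>Shifts with few exceptions, found by averaging\<close>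

lemma harm_le_powr:
  fixes q :: nat
  assumes "q > 0"
  shows "harm q \<le> 5 * real q powr (1 / 4)"
proof -
  have "harm q \<le> 1 + ln (real q)"
    using assms euler_mascheroni_sequence_decreasing[of 1 q] by (simp add: harm_expand)
  \<comment> \<open>For \<open>q = p\<^sup>2\<close>, any exponent below 1/2 makes the bound on
    \<open>harm q / q\<close> summable over \<open>p\<close> and keeps the leftover terms of lower
    order than the number of shifts averaged over; 1/4 is a convenient choice.\<close>
  also have "\<dots> \<le> real q powr (1 / 4) + 4 * real q powr (1 / 4)"
    using assms ln_powr_bound[of "real q" "1 / 4"] ge_one_powr_ge_zero[of "real q" "1 / 4"]
    by simp
  finally show ?thesis by simp
qed

text \<open>Let \<open>r = q - n mod q\<close> be the distance from \<open>n\<close> to the next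
  larger multiple of \<open>q\<close>. For \<open>x < r\<close> nothing is counted; otherwise the
  count is at most \<open>x / q + 1\<close>, and both terms are at most \<open>x / r\<close>. The
  gain is a bound linear in \<open>x\<close> without additive constant.\<close>

lemma card_dvd_shift_le:
  fixes n q x :: nat
  assumes "q > 0"
  shows "real (card {a. 0 < a \<and> a \<le> x \<and> q dvd n + a}) \<le> 2 * x / real (q - n mod q)"
proof (cases "x < q - n mod q")
  case True
  have "{a. 0 < a \<and> a \<le> x \<and> q dvd n + a} = {}"
  proof -
    have "\<not> q dvd n + a" if "0 < a" "a \<le> x" for a
    proof
      assume "q dvd n + a"
      hence "q dvd n mod q + a" by (metis dvd_eq_mod_eq_0 mod_add_left_eq)
      moreover have "0 < n mod q + a" "n mod q + a < q" using that True by auto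
      ultimately show False using dvd_imp_le by fastforce
    qed
    thus ?thesis by auto
  qed
  thus ?thesis by (metis card.empty divide_nonneg_nonneg of_nat_0 of_nat_0_le_iff)
next
  case False
  define r where "r = q - n mod q"
  have r: "r > 0" "r \<le> q" "r \<le> x" using False assms by (auto simp: r_def)
  let ?S = "{a. 0 < a \<and> a \<le> x \<and> q dvd n + a}"
  have inj: "inj_on (\<lambda>a. (n + a) div q) ?S"
    by (rule inj_onI) (metis (mono_tags, lifting) add_left_cancel dvd_mult_div_cancel mem_Collect_eq)
  have "(\<lambda>a. (n + a) div q) ` ?S \<subseteq> {n div q<..(n + x) div q}"
  proof (intro image_subsetI, unfold greaterThanAtMost_iff, intro conjI)
    fix a assume a: "a \<in> ?S"
    then obtain t where t: "n + a = q * t" by (auto elim: dvdE)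
    have "n < q * t" using t a by auto
    thus "n div q < (n + a) div q"
      unfolding t using assms by (simp add: div_less_iff_less_mult mult.commute)
    show "(n + a) div q \<le> (n + x) div q" using a by (intro div_le_mono) auto
  qed
  from card_inj_on_le[OF inj this]
  have "card ?S \<le> (n + x) div q - n div q" by simp
  also have "\<dots> \<le> x div q + 1"
  proof -
    have "n mod q + x mod q < 2 * q"
      using mod_less_divisor[OF assms, of n] mod_less_divisor[OF assms, of x] by linarith
    hence "(n mod q + x mod q) div q < 2" using assms by (simp add: div_less_iff_less_mult)
    thus ?thesis using div_add1_eq[of n x q] by linarith
  qed
  finally have "real (card ?S) \<le> real (x div q) + 1" by linarith
  moreover have "real (x div q) \<le> x / q" by (rule of_nat_div_le_of_nat)
  moreover have "x / q \<le> x / r" using r by (intro divide_left_mono) auto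
  moreover have "1 \<le> x / r" using r by simp
  ultimately have "real (card ?S) \<le> x / r + x / r" by linarith
  thus ?thesis by (simp add: r_def)
qed

text \<open>Multiplication by \<open>M\<close> permutes the residues modulo \<open>q\<close>, so the
  denominators are 1 to \<open>q\<close> in some order.\<close>

lemma sum_inverse_mult_mod:
  fixes M q :: nat
  assumes "coprime M q" "q > 0"
  shows "(\<Sum>m<q. 1 / real (q - m * M mod q)) = harm q"
proof -
  have inj: "inj_on (\<lambda>m. m * M mod q) {..<q}"
  proof (rule linorder_inj_onI')
    fix i j assume ij: "i \<in> {..<q}" "j \<in> {..<q}" "i < j"
    show "i * M mod q \<noteq> j * M mod q"
    proof
      assume "i * M mod q = j * M mod q"
      hence "q dvd j * M - i * M" using ij by (metis mod_eq_dvd_iff_nat mult_le_mono1 less_imp_le)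
      hence "q dvd (j - i) * M" by (simp add: diff_mult_distrib)
      hence "q dvd j - i" using assms by (simp add: coprime_commute coprime_dvd_mult_left_iff)
      thus False using ij by (auto dest!: dvd_imp_le)
    qed
  qed
  have im: "(\<lambda>m. m * M mod q) ` {..<q} = {..<q}"
    using assms by (intro endo_inj_surj inj) auto
  have "(\<Sum>m<q. 1 / real (q - m * M mod q)) = (\<Sum>r\<in>(\<lambda>m. m * M mod q) ` {..<q}. 1 / real (q - r))"
    by (simp add: sum.reindex[OF inj])
  also have "\<dots> = (\<Sum>r<q. 1 / real (q - r))" by (simp only: im)
  also have "\<dots> = harm q"
    unfolding harm_def by (rule sum.reindex_bij_witness[of _ "\<lambda>k. q - k" "\<lambda>r. q - r"]) (auto simp: field_simps)
  finally show ?thesis .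
qed

lemma sum_inverse_mult_mod_le:
  fixes M q N :: nat
  assumes "coprime M q" "q > 0"
  shows "(\<Sum>m=1..N. 1 / real (q - m * M mod q)) \<le> (real N / real q + 1) * harm q"
proof -
  define f where "f = (\<lambda>m. 1 / real (q - m * M mod q))"
  have block: "sum f {m * q..<m * q + q} = harm q" for m
  proof -
    have "sum f {m * q..<m * q + q} = (\<Sum>i<q. f (i + m * q))"
      using sum.shift_bounds_nat_ivl[of f 0 "m * q" q] by (simp add: add.commute lessThan_atLeast0)
    also have "\<dots> = (\<Sum>i<q. f i)"
      by (simp add: f_def add_mult_distrib mult.assoc mult.left_commute[of m])
    also have "(\<Sum>i<q. f i) = harm q" unfolding f_def by (rule sum_inverse_mult_mod) fact+
    finally show ?thesis .
  qed
  \<comment> \<open>Rounding up to whole blocks of length \<open>q\<close> costs at most one extra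
    block, the \<open>+ 1\<close> in the bound.\<close>
  have "N < Suc (N div q) * q" using assms by (metis div_less_iff_less_mult lessI)
  hence "sum f {1..N} \<le> sum f {..<Suc (N div q) * q}"
    by (intro sum_mono2) (auto simp: f_def)
  also have "\<dots> = (\<Sum>m<Suc (N div q). harm q)"
    using sum.nat_group[of f q "Suc (N div q)"] block by simp
  also have "\<dots> = (real (N div q) + 1) * harm q" by simp
  also have "\<dots> \<le> (real N / real q + 1) * harm q"
    by (intro mult_right_mono add_right_mono of_nat_div_le_of_nat harm_nonneg)
  finally show ?thesis by (simp add: f_def)
qed

text \<open>The first term is summable over \<open>p\<close>. The second, from the extra block, is
  made uniform in \<open>p\<close> through \<open>R\<close>, so that it can be multiplied by the
  number of primes.\<close>

lemma sum_inverse_mod_square_le: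
  fixes p :: nat
  assumes "coprime M p" "p > 0" "p\<^sup>2 \<le> R"
  shows "(\<Sum>m=1..N. 1 / real (p\<^sup>2 - m * M mod p\<^sup>2)) \<le>
           real (5 * N) * real p powr (- 3 / 2) + 5 * real R powr (1 / 4)"
proof -
  have p: "real p powr (- 3 / 2) = real (p\<^sup>2) powr (1 / 4) / real (p\<^sup>2)"
  proof -
    have "real p powr (- 3 / 2) = real p powr (1 / 2) / real p powr 2"
      using powr_diff[of "real p" "1 / 2" 2] by simp
    also have "real p powr (1 / 2) = (real p powr 2) powr (1 / 4)" by (subst powr_powr) simp
    also have "real p powr 2 = real (p\<^sup>2)" using assms by simp
    finally show ?thesis .
  qed
  have "(\<Sum>m=1..N. 1 / real (p\<^sup>2 - m * M mod p\<^sup>2)) \<le> (real N / real (p\<^sup>2) + 1) * harm (p\<^sup>2)"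
    using assms by (intro sum_inverse_mult_mod_le) auto
  also have "\<dots> \<le> (real N / real (p\<^sup>2) + 1) * (5 * real (p\<^sup>2) powr (1 / 4))"
    using assms by (intro mult_left_mono harm_le_powr) auto
  also have "\<dots> = 5 * N * (real (p\<^sup>2) powr (1 / 4) / real (p\<^sup>2)) + 5 * real (p\<^sup>2) powr (1 / 4)"
    by (simp add: algebra_simps)
  also have "\<dots> \<le> 5 * N * (real (p\<^sup>2) powr (1 / 4) / real (p\<^sup>2)) + 5 * real R powr (1 / 4)"
    using assms by (intro add_left_mono mult_left_mono powr_mono2) (auto simp flip: of_nat_power)
  finally show ?thesis unfolding p by simp
qed

text \<open>The order of choices matters: \<open>y\<close> makes the tail of \<open>s\<close> small
  and fixes \<open>M\<close>; only then is \<open>N\<close> taken large in terms of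
  \<open>M\<close>. The weight \<open>W m\<close> controls the exceptions for every \<open>x\<close>
  at once, so bounding its mean over \<open>m\<close> by \<open>\<epsilon> / 2\<close> is
  enough.\<close>

lemma exists_good_shift:
  fixes \<epsilon> :: real and L :: nat
  assumes "\<epsilon> > 0"
  shows "\<exists>n\<ge>L. \<forall>x. real (card {a \<in> SF. a \<le> x \<and> a < n \<and> n + a \<notin> SF}) \<le> \<epsilon> * x"
proof -
  define s where "s = (\<lambda>d::nat. real d powr (- 3 / 2))"
  have "summable s" unfolding s_def by (subst summable_real_powr_iff) simp
  \<comment> \<open>The mean of \<open>W\<close> is bounded by two parts of
    \<open>\<epsilon> / 4\<close>; this part carries the factor 5 of the harmonic bound, hence
    20.\<close>
  then obtain Y where Y: "\<And>m n. m \<ge> Y \<Longrightarrow> norm (sum s {m..<n}) < \<epsilon> / 20"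
    unfolding summable_Cauchy using assms by (metis divide_pos_pos zero_less_numeral)
  define y where "y = max (max Y L) 1"
  define M where "M = (fact y :: nat)\<^sup>2"
  have "M > 0" by (simp add: M_def)
  \<comment> \<open>The other part: at most \<open>sqrt R\<close> primes, each costing
    \<open>5 * R powr (1 / 4)\<close>, where \<open>R = 2 * N * M\<close>. For fixed
    \<open>M\<close> this has order 3/4 in \<open>N\<close>.\<close>
  have "((\<lambda>N. 5 * (2 * N * real M) powr (3 / 4) / N) \<longlongrightarrow> 0) at_top"
    using \<open>M > 0\<close> by real_asymp
  hence "eventually (\<lambda>N::real. 5 * (2 * N * real M) powr (3 / 4) / N < \<epsilon> / 4) at_top"
    using assms by (intro order_tendstoD) auto
  then obtain N0 where N0: "\<And>N. N \<ge> N0 \<Longrightarrow> 5 * (2 * N * real M) powr (3 / 4) / N < \<epsilon> / 4"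
    by (auto simp: eventually_at_top_linorder)
  define N where "N = nat \<lceil>max N0 1\<rceil>"
  have N: "N \<ge> 1" "real N \<ge> N0" by (auto simp: N_def le_nat_iff) linarith
  \<comment> \<open>As \<open>a < n\<close> and \<open>n \<le> N * M\<close>, the sum
    \<open>n + a\<close> stays below \<open>R\<close>, so only primes with
    \<open>p\<^sup>2 \<le> R\<close> can matter.\<close>
  define R where "R = 2 * N * M"
  have R: "5 * real R powr (3 / 4) \<le> N * (\<epsilon> / 4)"
    using N0[OF N(2)] N(1) by (simp add: R_def field_simps)
  define P where "P = {p. prime p \<and> y < p \<and> p\<^sup>2 \<le> R}"
  have P_le: "real p \<le> sqrt (real R)" if "p\<^sup>2 \<le> R" for p
    using that by (intro real_le_rsqrt) (simp flip: of_nat_power)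
  have P_sub: "P \<subseteq> {1..nat \<lfloor>sqrt (real R)\<rfloor>}"
    using P_le by (auto simp: P_def le_nat_floor intro: prime_ge_1_nat)
  hence finP: "finite P" by (rule finite_subset) simp
  have cardP: "real (card P) \<le> sqrt (real R)"
  proof -
    have "card P \<le> nat \<lfloor>sqrt (real R)\<rfloor>" using card_mono[OF _ P_sub] by simp
    thus ?thesis by (meson of_nat_floor of_nat_le_iff order_trans real_sqrt_ge_zero of_nat_0_le_iff)
  qed
  define W where "W = (\<lambda>m. \<Sum>p\<in>P. 1 / real (p\<^sup>2 - m * M mod p\<^sup>2))"
  have cop: "coprime M p" if "p \<in> P" for p
  proof -
    have "\<not> p dvd fact y" using that by (auto simp: P_def prime_dvd_fact_iff)
    hence "coprime (fact y) p" using that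
      by (metis (no_types, lifting) P_def coprime_commute mem_Collect_eq prime_imp_coprime)
    thus ?thesis by (simp add: M_def)
  qed
  have "(\<Sum>m=1..N. W m) = (\<Sum>p\<in>P. \<Sum>m=1..N. 1 / real (p\<^sup>2 - m * M mod p\<^sup>2))"
    unfolding W_def by (rule sum.swap)
  also have "\<dots> \<le> (\<Sum>p\<in>P. 5 * N * s p + 5 * real R powr (1 / 4))"
    unfolding s_def
  proof (rule sum_mono)
    fix p assume p: "p \<in> P"
    show "(\<Sum>m=1..N. 1 / real (p\<^sup>2 - m * M mod p\<^sup>2)) \<le>
            real (5 * N) * real p powr (- 3 / 2) + 5 * real R powr (1 / 4)"
      using p by (intro sum_inverse_mod_square_le cop) (auto simp: P_def prime_gt_0_nat)
  qed
  also have "\<dots> = 5 * N * sum s P + card P * (5 * real R powr (1 / 4))"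
    by (simp add: sum.distrib sum_distrib_left)
  also have "\<dots> \<le> 5 * N * (\<epsilon> / 20) + N * (\<epsilon> / 4)"
  proof (intro add_mono mult_left_mono)
    have "sum s P \<le> sum s {y..<nat \<lfloor>sqrt (real R)\<rfloor> + 1}"
      using P_sub by (intro sum_mono2) (auto simp: s_def P_def)
    also have "\<dots> \<le> \<epsilon> / 20"
      using Y[of y "nat \<lfloor>sqrt (real R)\<rfloor> + 1"] unfolding real_norm_def y_def by linarith
    finally show "sum s P \<le> \<epsilon> / 20" .
    have "card P * (5 * real R powr (1 / 4)) \<le> sqrt (real R) * (5 * real R powr (1 / 4))"
      by (intro mult_right_mono cardP) auto
    also have "\<dots> = 5 * real R powr (3 / 4)" by (simp flip: powr_half_sqrt powr_add)
    also note R
    finally show "card P * (5 * real R powr (1 / 4)) \<le> N * (\<epsilon> / 4)" .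
  qed auto
  finally have "(\<Sum>m=1..N. W m) \<le> N * (\<epsilon> / 2)" by (simp add: mult.commute)
  hence "\<exists>m\<in>{1..N}. W m \<le> \<epsilon> / 2"
  proof (rule contrapos_pp)
    assume "\<not> (\<exists>m\<in>{1..N}. W m \<le> \<epsilon> / 2)"
    hence "(\<Sum>m=1..N. \<epsilon> / 2) < (\<Sum>m=1..N. W m)"
      using N by (intro sum_strict_mono) (auto simp: not_le)
    thus "\<not> (\<Sum>m=1..N. W m) \<le> N * (\<epsilon> / 2)" by simp
  qed
  then obtain m where m: "m \<in> {1..N}" "W m \<le> \<epsilon> / 2" by blast
  define n where "n = m * M"
  have n: "0 < n" "2 * n \<le> R" using m \<open>M > 0\<close> by (auto simp: n_def R_def)
  have "L \<le> y" by (simp add: y_def)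
  also have "y \<le> fact y" by (rule fact_ge_self)
  also have "\<dots> \<le> M" by (simp add: M_def power2_eq_square)
  also have "\<dots> \<le> n" using m by (simp add: n_def)
  finally have "n \<ge> L" .
  moreover have "real (card {a \<in> SF. a \<le> x \<and> a < n \<and> n + a \<notin> SF}) \<le> \<epsilon> * x" for x
  proof -
    have sub: "{a \<in> SF. a \<le> x \<and> a < n \<and> n + a \<notin> SF} \<subseteq>
            (\<Union>p\<in>P. {a. 0 < a \<and> a \<le> x \<and> p\<^sup>2 dvd n + a})"
    proof
      fix a assume a: "a \<in> {a \<in> SF. a \<le> x \<and> a < n \<and> n + a \<notin> SF}"
      hence a0: "0 < a" "a \<le> x" "a < n" "squarefree a" by (auto simp: SF_def)
      have "\<not> squarefree (n + a)" using a a0 by (auto simp: SF_def)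
      then obtain p where p: "prime p" "p\<^sup>2 dvd n + a"
        using a0 squarefree_factorial_semiring[of "n + a"] by auto
      \<comment> \<open>For \<open>p \<le> y\<close>, \<open>p\<^sup>2\<close> divides
        \<open>M\<close> and hence \<open>n\<close>, so it would divide the squarefree number
        \<open>a\<close>.\<close>
      have "y < p"
      proof (rule ccontr)
        assume "\<not> y < p"
        hence "p dvd fact y" using p by (simp add: prime_dvd_fact_iff)
        hence "p\<^sup>2 dvd M" by (simp add: M_def)
        hence "p\<^sup>2 dvd n" by (simp add: n_def)
        hence "p\<^sup>2 dvd a" using p by (simp add: dvd_add_right_iff)
        hence "is_unit p" by (rule squarefreeD[OF a0(4)])
        thus False using p(1) not_prime_unit by blast
      qed
      moreover have "p\<^sup>2 \<le> R" using dvd_imp_le[OF p(2)] n a0 by linarith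
      ultimately show "a \<in> (\<Union>p\<in>P. {a. 0 < a \<and> a \<le> x \<and> p\<^sup>2 dvd n + a})"
        using p a0 by (auto simp: P_def)
    qed
    have "card {a \<in> SF. a \<le> x \<and> a < n \<and> n + a \<notin> SF} \<le>
            card (\<Union>p\<in>P. {a. 0 < a \<and> a \<le> x \<and> p\<^sup>2 dvd n + a})"
      using finP by (intro card_mono sub) auto
    also have "\<dots> \<le> (\<Sum>p\<in>P. card {a. 0 < a \<and> a \<le> x \<and> p\<^sup>2 dvd n + a})"
      by (rule card_UN_le[OF finP])
    finally have "real (card {a \<in> SF. a \<le> x \<and> a < n \<and> n + a \<notin> SF}) \<le>
        (\<Sum>p\<in>P. real (card {a. 0 < a \<and> a \<le> x \<and> p\<^sup>2 dvd n + a}))"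
      by (simp flip: of_nat_sum)
    also have "\<dots> \<le> (\<Sum>p\<in>P. 2 * x / real (p\<^sup>2 - n mod p\<^sup>2))"
      by (intro sum_mono card_dvd_shift_le) (auto simp: P_def prime_gt_0_nat)
    also have "\<dots> = 2 * x * W m" by (simp add: W_def n_def sum_distrib_left)
    also have "\<dots> \<le> 2 * x * (\<epsilon> / 2)" by (intro mult_left_mono m) auto
    finally show ?thesis by (simp add: mult.commute)
  qed
  ultimately show ?thesis by blast
qed

section \<open>Density after removing a sparse union, and along an enumeration\<close>

lemma density_zero_union:
  fixes B :: "nat \<Rightarrow> nat set"
  assumes fin: "\<And>k. finite (B k)"
  assumes bound: "\<And>k x. real (card (B k \<inter> {..x})) \<le> (1 / 2) ^ k * real x"
  shows "((\<lambda>x. real (card ((\<Union>k. B k) \<inter> initial_seg x)) / x) \<longlongrightarrow> 0) at_top"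
proof (rule tendstoI)
  fix e :: real assume "e > 0"
  have "(\<lambda>k. 2 * (1 / 2 :: real) ^ k) \<longlonglongrightarrow> 0"
    by (rule tendsto_mult_right_zero, rule LIMSEQ_realpow_zero) auto
  hence "eventually (\<lambda>k. 2 * (1 / 2 :: real) ^ k < e / 2) sequentially"
    using \<open>e > 0\<close> by (intro order_tendstoD(2)[where y = 0]) auto
  then obtain K where K: "2 * (1 / 2 :: real) ^ K < e / 2"
    by (auto simp: eventually_at_top_linorder)
  define C where "C = card (\<Union>k<K. B k)"
  show "eventually (\<lambda>x. dist (real (card ((\<Union>k. B k) \<inter> initial_seg x)) / x) 0 < e) at_top"
    unfolding eventually_at_top_linorder
  proof (intro exI allI impI)
    fix x :: real assume x: "x \<ge> max 1 (2 * (real C + 1) / e)"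
    define n where "n = nat \<lfloor>x\<rfloor>"
    have n: "real n \<le> x" "n \<ge> 1" using x by (auto simp: n_def le_nat_iff)
    \<comment> \<open>As \<open>n < 2 ^ n\<close>, the bound on the cardinality drops below 1 from
      \<open>k = n\<close> on.\<close>
    have empty: "B k \<inter> {..n} = {}" if "n \<le> k" for k
    proof -
      have "n < 2 ^ k" using that less_exp order_le_less_trans by blast
      hence "real n < 2 ^ k" by (metis of_nat_less_iff of_nat_numeral of_nat_power)
      hence "(1 / 2) ^ k * real n < 1" by (simp add: power_one_over field_simps)
      hence "real (card (B k \<inter> {..n})) < 1" using bound[of k n] by linarith
      thus ?thesis using fin by auto
    qed
    \<comment> \<open>The finite sets with index below \<open>K\<close> contribute at most the
      constant \<open>C\<close>; the others contribute a geometric tail times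
      \<open>n\<close>.\<close>
    have "(\<Union>k. B k) \<inter> initial_seg x \<subseteq> (\<Union>k<K. B k) \<union> (\<Union>k\<in>{K..<n}. B k \<inter> {..n})"
    proof
      fix a assume "a \<in> (\<Union>k. B k) \<inter> initial_seg x"
      then obtain k where k: "a \<in> B k" "a \<le> n" by (auto simp: initial_seg_eq n_def)
      with empty[of k] have "k < n" by (cases "k < n") auto
      thus "a \<in> (\<Union>k<K. B k) \<union> (\<Union>k\<in>{K..<n}. B k \<inter> {..n})"
        using k by (cases "k < K") auto
    qed
    hence "card ((\<Union>k. B k) \<inter> initial_seg x) \<le> card ((\<Union>k<K. B k) \<union> (\<Union>k\<in>{K..<n}. B k \<inter> {..n}))"
      by (intro card_mono) (auto simp: fin)
    also have "\<dots> \<le> C + card (\<Union>k\<in>{K..<n}. B k \<inter> {..n})"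
      unfolding C_def by (rule card_Un_le)
    also have "\<dots> \<le> C + (\<Sum>k\<in>{K..<n}. card (B k \<inter> {..n}))"
      by (intro add_left_mono card_UN_le) auto
    finally have count: "real (card ((\<Union>k. B k) \<inter> initial_seg x)) \<le>
        real C + (\<Sum>k\<in>{K..<n}. real (card (B k \<inter> {..n})))"
      by (simp flip: of_nat_sum of_nat_add)
    have "(\<Sum>k\<in>{K..<n}. real (card (B k \<inter> {..n}))) \<le> e / 2 * x"
    proof -
      have "(\<Sum>k\<in>{K..<n}. (1 / 2 :: real) ^ k) \<le> 2 * (1 / 2) ^ K"
      proof (cases "K \<le> n")
        case True
        hence "(\<Sum>k\<in>{K..<n}. (1 / 2 :: real) ^ k) = 2 * (1 / 2) ^ K - 2 * (1 / 2) ^ n"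
          by (induction n rule: dec_induct) auto
        thus ?thesis by simp
      qed auto
      hence geo: "(\<Sum>k\<in>{K..<n}. (1 / 2 :: real) ^ k) \<le> e / 2" using K by linarith
      have "(\<Sum>k\<in>{K..<n}. real (card (B k \<inter> {..n}))) \<le> (\<Sum>k\<in>{K..<n}. (1 / 2) ^ k * real n)"
        by (intro sum_mono bound)
      also have "\<dots> = (\<Sum>k\<in>{K..<n}. (1 / 2) ^ k) * real n" by (simp add: sum_distrib_right)
      also have "\<dots> \<le> e / 2 * x" using geo n \<open>e > 0\<close> by (intro mult_mono) auto
      finally show ?thesis .
    qed
    moreover have "real C < e / 2 * x" using x \<open>e > 0\<close> by (simp add: field_simps)
    ultimately have "real (card ((\<Union>k. B k) \<inter> initial_seg x)) < e * x" using count by simp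
    thus "dist (real (card ((\<Union>k. B k) \<inter> initial_seg x)) / x) 0 < e"
      using x by (simp add: dist_real_def field_simps)
  qed
qed

lemma has_natural_density_diff:
  assumes "has_natural_density S d" "A \<subseteq> S"
    and "((\<lambda>x. real (card ((S - A) \<inter> initial_seg x)) / x) \<longlongrightarrow> 0) at_top"
  shows "has_natural_density A d"
proof -
  have "real (card (A \<inter> initial_seg x)) / x =
      real (card (S \<inter> initial_seg x)) / x - real (card ((S - A) \<inter> initial_seg x)) / x" for x
  proof -
    have "S \<inter> initial_seg x = (A \<inter> initial_seg x) \<union> ((S - A) \<inter> initial_seg x)"
      using assms(2) by auto
    hence "card (S \<inter> initial_seg x) = card (A \<inter> initial_seg x) + card ((S - A) \<inter> initial_seg x)"
      by (simp add: card_Un_disjoint[symmetric] disjoint_iff)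
    thus ?thesis by (simp add: add_divide_distrib)
  qed
  thus ?thesis
    using tendsto_diff[OF assms(1)[unfolded has_natural_density_def] assms(3)]
    by (simp add: has_natural_density_def)
qed

text \<open>The counting function at \<open>a j\<close> equals \<open>j\<close>, so the density
  taken along these points gives the limit of \<open>j / a j\<close>, which is then inverted.
  Positivity of \<open>d\<close> also forces \<open>A\<close> to be infinite.\<close>

lemma enumerate_density:
  fixes A :: "nat set" and d :: real
  assumes dens: "has_natural_density A d" and "d > 0" and "0 \<notin> A"
  obtains a where "strict_mono_on {1..} a" "A = a ` {1..}" "(\<lambda>j. real (a j) / real j) \<longlonglongrightarrow> 1 / d"
proof -
  have inf: "infinite A"
  proof
    assume "finite A"
    have "((\<lambda>x. real (card (A \<inter> initial_seg x)) / x) \<longlongrightarrow> 0) at_top"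
    proof (rule tendsto_sandwich[OF _ _ tendsto_const])
      show "((\<lambda>x. real (card A) / x) \<longlongrightarrow> 0) at_top" by real_asymp
      show "eventually (\<lambda>x. real (card (A \<inter> initial_seg x)) / x \<le> real (card A) / x) at_top"
        using eventually_gt_at_top[of 0]
        by eventually_elim (auto intro!: divide_right_mono card_mono \<open>finite A\<close>)
      show "eventually (\<lambda>x. 0 \<le> real (card (A \<inter> initial_seg x)) / x) at_top"
        using eventually_gt_at_top[of 0] by eventually_elim auto
    qed
    thus False using tendsto_unique[OF _ dens[unfolded has_natural_density_def]] \<open>d > 0\<close> by auto
  qed
  \<comment> \<open>\<open>enumerate\<close> starts at index 0, the sequence at 1. Truncated
    subtraction repeats the first element at 0, so strict monotonicity begins at 1.\<close>
  define a where "a = (\<lambda>j. enumerate A (j - 1))"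
  have mono: "strict_mono_on {1..} a"
    using inf by (auto simp: strict_mono_on_def a_def)
  have range_a: "A = a ` {1..}"
  proof -
    have "a ` {1..} = range (enumerate A)"
      by (force simp: a_def image_iff Bex_def intro: exI[of _ "Suc _"])
    thus ?thesis using range_enumerate[OF inf] by simp
  qed
  have card_a: "card (A \<inter> initial_seg (real (a j))) = j" if "j \<ge> 1" for j
  proof -
    have "A \<inter> initial_seg (real (a j)) = a ` {1..j}"
    proof (intro equalityI subsetI)
      fix n assume n: "n \<in> A \<inter> initial_seg (real (a j))"
      then obtain i where i: "n = a i" "i \<ge> 1" using range_a by auto
      moreover have "a i \<le> a j" using n i by (auto simp: initial_seg_def)
      hence "i \<le> j" using mono that i by (meson atLeast_iff leI leD strict_mono_onD)
      ultimately show "n \<in> a ` {1..j}" by auto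
    next
      fix n assume "n \<in> a ` {1..j}"
      then obtain i where i: "n = a i" "i \<ge> 1" "i \<le> j" by auto
      have "a i \<le> a j" using inf i by (auto simp: a_def)
      moreover have "n \<in> A" using i range_a by auto
      ultimately show "n \<in> A \<inter> initial_seg (real (a j))"
        using i \<open>0 \<notin> A\<close> by (auto simp: initial_seg_def intro!: gr0I)
    qed
    moreover have "inj_on a {1..j}"
      using mono by (meson strict_mono_on_imp_inj_on inj_on_subset atLeastAtMost_iff atLeast_iff subsetI)
    ultimately show ?thesis by (simp add: card_image)
  qed
  have "filterlim (\<lambda>j. real (a j)) at_top sequentially"
  proof (rule filterlim_at_top_mono)
    show "filterlim (\<lambda>j. real j - 1) at_top sequentially" by real_asymp
    have "real j - 1 \<le> real (a j)" for j
    proof -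
      have "j \<le> a j + 1" using le_enumerate[OF inf, of "j - 1"] by (simp add: a_def)
      thus ?thesis by linarith
    qed
    thus "eventually (\<lambda>j. real j - 1 \<le> real (a j)) sequentially" by (intro always_eventually) simp
  qed
  from filterlim_compose[OF dens[unfolded has_natural_density_def] this]
  have "(\<lambda>j. real (card (A \<inter> initial_seg (real (a j)))) / real (a j)) \<longlonglongrightarrow> d" .
  moreover have "eventually (\<lambda>j. real (card (A \<inter> initial_seg (real (a j)))) / real (a j) = real j / real (a j)) sequentially"
    using eventually_ge_at_top[of 1] by eventually_elim (simp add: card_a)
  ultimately have "(\<lambda>j. real j / real (a j)) \<longlonglongrightarrow> d"
    by (rule Lim_transform_eventually)
  from tendsto_inverse[OF this] have "(\<lambda>j. real (a j) / real j) \<longlonglongrightarrow> 1 / d"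
    using \<open>d > 0\<close> by (simp add: inverse_eq_divide)
  with mono range_a show ?thesis by (rule that)
qed

section \<open>Removing the exceptions of infinitely many shifts\<close>

theorem theorem1p4:
  shows "\<exists>(A :: nat set) (a :: nat \<Rightarrow> nat).
           strict_mono_on {1..} a \<and> A = a ` {1..} \<and> A \<subseteq> SF \<and>
           property_Q A \<and>
           has_natural_density A (6 / pi\<^sup>2) \<and>
           (\<lambda>j. real (a j) / real j) \<longlonglongrightarrow> pi\<^sup>2 / 6"
proof -
  \<comment> \<open>The lower bound \<open>Suc k\<close> makes the shifts positive and
    unbounded.\<close>
  have "\<exists>n\<ge>Suc k. \<forall>x. real (card {a \<in> SF. a \<le> x \<and> a < n \<and> n + a \<notin> SF}) \<le> (1 / 2) ^ k * real x" for k
    by (rule exists_good_shift) simp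
  hence "\<forall>k. \<exists>n. Suc k \<le> n \<and>
      (\<forall>x. real (card {a \<in> SF. a \<le> x \<and> a < n \<and> n + a \<notin> SF}) \<le> (1 / 2) ^ k * real x)"
    by blast
  from choice[OF this] obtain n where n: "\<And>k. n k \<ge> Suc k"
    "\<And>k x. real (card {a \<in> SF. a \<le> x \<and> a < n k \<and> n k + a \<notin> SF}) \<le> (1 / 2) ^ k * real x"
    by blast
  \<comment> \<open>The condition \<open>a < n k\<close> matches property Q and keeps
    \<open>B k\<close> finite. Removing further elements never spoils a good shift, so all
    \<open>n k\<close> work for \<open>A\<close> simultaneously.\<close>
  define B where "B = (\<lambda>k. {a \<in> SF. a < n k \<and> n k + a \<notin> SF})"
  define A where "A = SF - (\<Union>k. B k)"
  have "((\<lambda>x. real (card ((\<Union>k. B k) \<inter> initial_seg x)) / x) \<longlongrightarrow> 0) at_top"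
  proof (rule density_zero_union)
    show "finite (B k)" for k by (rule finite_subset[of _ "{..n k}"]) (auto simp: B_def)
    have "B k \<inter> {..x} = {a \<in> SF. a \<le> x \<and> a < n k \<and> n k + a \<notin> SF}" for k x
      by (auto simp: B_def)
    thus "real (card (B k \<inter> {..x})) \<le> (1 / 2) ^ k * real x" for k x using n(2) by simp
  qed
  moreover have "SF - A = (\<Union>k. B k)" by (auto simp: A_def B_def)
  ultimately have dens: "has_natural_density A (6 / pi\<^sup>2)"
    by (intro has_natural_density_diff[OF squarefree_density]) (auto simp: A_def)
  have "A \<subseteq> SF" by (auto simp: A_def)
  have Q: "property_Q A"
    unfolding property_Q_def infinite_nat_iff_unbounded_le
  proof
    fix m
    have "0 < n m" "m \<le> n m" using n(1)[of m] by auto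
    moreover have "\<forall>a\<in>A. a < n m \<longrightarrow> n m + a \<in> SF" by (auto simp: A_def B_def)
    ultimately show "\<exists>l\<ge>m. l \<in> {l. 0 < l \<and> (\<forall>a\<in>A. a < l \<longrightarrow> l + a \<in> SF)}" by blast
  qed
  have "0 \<notin> A" by (simp add: A_def SF_def)
  moreover have "0 < 6 / pi\<^sup>2" by simp
  ultimately obtain a where "strict_mono_on {1..} a" "A = a ` {1..}"
    "(\<lambda>j. real (a j) / real j) \<longlonglongrightarrow> 1 / (6 / pi\<^sup>2)"
    using enumerate_density[OF dens] by blast
  thus ?thesis using dens Q \<open>A \<subseteq> SF\<close> by (intro exI[of _ A] exI[of _ a]) auto
qed

end
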